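(* Let $G$ be a nontrivial group, let $H$ be a subgroup of $G$, and let $f: G \times X \rightarrow X$ be an action of $G$ on a set $X$. If $H_{x} \nsubseteq H_{y}$ for all $x, y \in X$ such that $x \neq y$, then $\mathrm{ncl}_{G}(H)\,\mathrm{Ker}(f)$ is an essential subgroup of $G$.
   Context: A normal subgroup $E$ of a group $G$ is called an essential subgroup of $G$ if every nontrivial normal subgroup of $G$ intersects $E$ nontrivially. For $x \in X$, $H_x = \{h \in H \mid hx = x\}$ denotes the stabilizer of $x$ in $H$ (under the action restricted to $H$). $\mathrm{ncl}_{G}(H)$ denotes the normal closure of $H$ in $G$, i.e. the smallest normal subgroup of $G$ containing $H$. $\mathrm{Ker}(f) = \{g \in G \mid gx = x \text{ for all } x \in X\}$ is the kernel of the action. For subsets $A, B$ of $G$, $AB = \{ab \mid a \in A, b \in B\}$. *)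

theory Defs
  imports "HOL-Algebra.Algebra"
begin

definition normal_closure :: "('a, 'm) monoid_scheme \<Rightarrow> 'a set \<Rightarrow> 'a set"
  where "normal_closure G H = \<Inter> {N. N \<lhd> G \<and> H \<subseteq> N}"

lemma (in group) carrier_normal: "carrier G \<lhd> G"
  unfolding normal_inv_iff by (simp add: subgroup_self)

lemma (in group) normal_closure_normal:
  assumes "H \<subseteq> carrier G"
  shows "normal_closure G H \<lhd> G"
proof -
  have ne: "{N. N \<lhd> G \<and> H \<subseteq> N} \<noteq> {}"
    using carrier_normal assms by blast
  have "subgroup (normal_closure G H) G"
    unfolding normal_closure_def
    using ne by (intro subgroups_Inter) (auto simp: normal_imp_subgroup)
  then show ?thesis
    unfolding normal_inv_iff normal_closure_def by blast
qed

lemma normal_closure_superset: "H \<subseteq> normal_closure G H"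
  by (auto simp: normal_closure_def)

lemma normal_closure_least: "\<lbrakk>N \<lhd> G; H \<subseteq> N\<rbrakk> \<Longrightarrow> normal_closure G H \<subseteq> N"
  by (auto simp: normal_closure_def)

definition action_kernel :: "('a, 'm) monoid_scheme \<Rightarrow> 'b set \<Rightarrow> ('a \<Rightarrow> 'b \<Rightarrow> 'b) \<Rightarrow> 'a set"
  where "action_kernel G S \<phi> = {g \<in> carrier G. \<forall>x\<in>S. \<phi> g x = x}"

lemma (in group_action) action_kernel_eq_kernel:
  "action_kernel G E \<phi> = kernel G (BijGroup E) \<phi>"
proof -
  have "(\<forall>x\<in>E. \<phi> g x = x) \<longleftrightarrow> \<phi> g = (\<lambda>x\<in>E. x)" if "g \<in> carrier G" for g
  proof
    have "\<phi> g \<in> extensional E"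
      using bij_prop0[OF that] by (simp add: Bij_def)
    then show "\<phi> g = (\<lambda>x\<in>E. x)" if "\<forall>x\<in>E. \<phi> g x = x"
      using that by (auto intro: extensionalityI[of _ E])
  qed simp
  then show ?thesis
    by (auto simp: action_kernel_def kernel_def BijGroup_def)
qed

definition essential_subgroup :: "'a set \<Rightarrow> ('a, 'm) monoid_scheme \<Rightarrow> bool"
  where "essential_subgroup E G \<longleftrightarrow>
    E \<lhd> G \<and> (\<forall>N. N \<lhd> G \<and> N \<noteq> {\<one>\<^bsub>G\<^esub>} \<longrightarrow> N \<inter> E \<noteq> {\<one>\<^bsub>G\<^esub>})"

end

theory Submission
  imports Defs
begin

text \<open>
  A normal subgroup \<open>N\<close> meeting \<open>E = ncl(H) Ker\<close> trivially commutes with \<open>E\<close>, hence with \<open>H\<close>.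
  So \<open>H\<^sub>x\<close> fixes \<open>n x\<close> for each \<open>n \<in> N\<close>, and the hypothesis forces \<open>n x = x\<close>.
  Thus \<open>N\<close> lies in the kernel of the action, a subset of \<open>E\<close>, and is trivial.
\<close>

lemma (in group) subset_set_mult_subgroups:
  assumes "subgroup A G" "subgroup B G"
  shows "A \<subseteq> A <#> B" and "B \<subseteq> A <#> B"
proof -
  interpret A: subgroup A G by fact
  interpret B: subgroup B G by fact
  show "A \<subseteq> A <#> B"
    unfolding set_mult_def by (force intro: bexI[of _ "\<one>"])
  have "x \<in> A <#> B" if "x \<in> B" for x
    unfolding set_mult_def using that by (intro UN_I[of "\<one>"] UN_I[of x]) auto
  then show "B \<subseteq> A <#> B"
    by blast
qed

lemma (in group_action) action_kernel_normal: "action_kernel G E \<phi> \<lhd> G"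
  unfolding action_kernel_eq_kernel
  using group_hom group_hom.normal_kernel by blast

text \<open>Both sides of \<open>g \<otimes> h = h \<otimes> g\<close> act on \<open>x\<close>
  alike, and on the left \<open>h\<close> is absorbed because it fixes \<open>x\<close>.\<close>

lemma (in group_action) commuting_fixes:
  assumes "g \<in> carrier G" "h \<in> carrier G" "g \<otimes> h = h \<otimes> g" "x \<in> E" "\<phi> h x = x"
  shows "\<phi> h (\<phi> g x) = \<phi> g x"
  using assms by (metis composition_rule)

theorem theorem2p3:
  fixes G :: "('a, 'm) monoid_scheme"
    and H :: "'a set"
    and S :: "'b set"
    and \<phi> :: "'a \<Rightarrow> 'b \<Rightarrow> 'b"
  assumes "group G"
    and "carrier G \<noteq> {\<one>\<^bsub>G\<^esub>}"
    and "subgroup H G"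
    and "group_action G S \<phi>"
    and "\<And>x y. \<lbrakk>x \<in> S; y \<in> S; x \<noteq> y\<rbrakk> \<Longrightarrow>
           \<not> stabilizer (G\<lparr>carrier := H\<rparr>) \<phi> x \<subseteq> stabilizer (G\<lparr>carrier := H\<rparr>) \<phi> y"
  shows "essential_subgroup (normal_closure G H <#>\<^bsub>G\<^esub> action_kernel G S \<phi>) G"
proof -
  interpret group G by fact
  interpret group_action G S \<phi> by fact
  let ?C = "normal_closure G H" and ?K = "action_kernel G S \<phi>"
  let ?P = "?C <#>\<^bsub>G\<^esub> ?K"
  have HG: "H \<subseteq> carrier G"
    using assms(3) by (rule subgroup.subset)
  have C: "?C \<lhd> G"
    using HG by (rule normal_closure_normal)
  have K: "?K \<lhd> G"
    by (rule action_kernel_normal)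
  have P: "?P \<lhd> G"
    using C K by (rule normal_subgroup_set_mult_closed)
  have CP: "?C \<subseteq> ?P" and KP: "?K \<subseteq> ?P"
    using C K by (simp_all add: subset_set_mult_subgroups normal_imp_subgroup)
  \<comment> \<open>The contrapositive of the second clause of
    \<open>essential_subgroup_def\<close>.\<close>
  have trivial: "N = {\<one>\<^bsub>G\<^esub>}" if N: "N \<lhd> G" and NP: "N \<inter> ?P = {\<one>\<^bsub>G\<^esub>}" for N
  proof -
    have NG: "N \<subseteq> carrier G"
      using N by (simp add: normal_imp_subgroup subgroup.subset)
    have "\<phi> n x = x" if n: "n \<in> N" and x: "x \<in> S" for n x
    proof (rule ccontr)
      assume "\<phi> n x \<noteq> x"
      moreover have "\<phi> n x \<in> S"
        using n x NG element_image by blast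
      \<comment> \<open>This inclusion contradicts the hypothesis on stabilizers for the distinct
        points \<open>x\<close> and \<open>\<phi> n x\<close>.\<close>
      moreover have "stabilizer (G\<lparr>carrier := H\<rparr>) \<phi> x \<subseteq> stabilizer (G\<lparr>carrier := H\<rparr>) \<phi> (\<phi> n x)"
      proof
        fix h assume "h \<in> stabilizer (G\<lparr>carrier := H\<rparr>) \<phi> x"
        then have h: "h \<in> H" "\<phi> h x = x"
          by (simp_all add: stabilizer_def)
        then have "h \<in> ?P"
          using CP normal_closure_superset[of H G] by blast
        \<comment> \<open>The commutator of \<open>n\<close> and \<open>h\<close> lies in both
          normal subgroups \<open>N\<close> and \<open>?P\<close>, hence in their trivial
          intersection.\<close>
        then have "n \<otimes>\<^bsub>G\<^esub> h = h \<otimes>\<^bsub>G\<^esub> n"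
          using normal_imp_commuting[OF N P _ n] NP by simp
        then have "\<phi> h (\<phi> n x) = \<phi> n x"
          using commuting_fixes n x h HG NG by blast
        then show "h \<in> stabilizer (G\<lparr>carrier := H\<rparr>) \<phi> (\<phi> n x)"
          using h by (simp add: stabilizer_def)
      qed
      ultimately show False
        using assms(5) x by metis
    qed
    then have "N \<subseteq> ?K"
      using NG by (auto simp: action_kernel_def)
    \<comment> \<open>The factor \<open>?K\<close> puts \<open>N\<close> inside \<open>?P\<close>,
      so \<open>N\<close> equals \<open>N \<inter> ?P\<close>.\<close>
    then show ?thesis
      using KP NP by blast
  qed
  show ?thesis
    unfolding essential_subgroup_def using P trivial by blast
qed

end
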